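(* There is no non-trivial minimal t.d.s. which is $\mathcal{F}_{\mathrm{s}}$-independent of order $2$.
   Context: $\mathbb{Z}_+=\{0,1,2,\dots\}$. A t.d.s. $(X,T)$ is a (nonempty) compact metrizable space $X$ with a surjective continuous map $T:X\to X$; it is non-trivial if $X$ has more than one point, and minimal if every orbit $\{T^nx:n\in\mathbb{Z}_+\}$ is dense in $X$. A set $F\subseteq\mathbb{Z}_+$ is an independence set for a tuple $(A_1,\dots,A_k)$ of subsets of $X$ if for every nonempty finite $J\subseteq F$ and every $s\in\{1,\dots,k\}^J$ one has $\bigcap_{j\in J}T^{-j}A_{s(j)}\neq\emptyset$. $\mathrm{Ind}(A_1,\dots,A_k)$ denotes the collection of all independence sets of $(A_1,\dots,A_k)$. For a collection $\mathcal{F}$ of subsets of $\mathbb{Z}_+$ that is hereditary upward, $(X,T)$ is $\mathcal{F}$-independent of order $k$ if $\mathrm{Ind}(U_1,\dots,U_k)\cap\mathcal{F}\neq\emptyset$ for all nonempty open subsets $U_1,\dots,U_k$ of $X$. An infinite set $\{s_1<s_2<\cdots\}\subseteq\mathbb{Z}_+$ is syndetic if $\{s_{n+1}-s_n:n\in\mathbb{N}\}$ is bounded; $\mathcal{F}_{\mathrm{s}}$ is the family of syndetic sets. *)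

theory Defs
  imports "HOL-Analysis.Analysis"
begin

text \<open>
  The space is an abstract topology, so that metrizability is assumed without fixing a metric.
  The values of \<open>T\<close> outside the carrier are irrelevant.
\<close>

definition tds :: "'a topology \<Rightarrow> ('a \<Rightarrow> 'a) \<Rightarrow> bool" where
  "tds X T \<longleftrightarrow>
     topspace X \<noteq> {} \<and> compact_space X \<and> metrizable_space X \<and>
     continuous_map X X T \<and> T ` topspace X = topspace X"

definition nontrivial_tds :: "'a topology \<Rightarrow> ('a \<Rightarrow> 'a) \<Rightarrow> bool" where
  "nontrivial_tds X T \<longleftrightarrow> tds X T \<and> (\<exists>x\<in>topspace X. \<exists>y\<in>topspace X. x \<noteq> y)"

definition minimal_tds :: "'a topology \<Rightarrow> ('a \<Rightarrow> 'a) \<Rightarrow> bool" where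
  "minimal_tds X T \<longleftrightarrow>
     tds X T \<and> (\<forall>x\<in>topspace X. X closure_of {(T ^^ n) x |n. True} = topspace X)"

text \<open>
  A tuple \<open>(A\<^sub>1, \<dots>, A\<^sub>k)\<close> is a function on indices of which only the values on \<open>{1..k}\<close> matter.
  The preimages under the iterates of \<open>T\<close> are taken within the carrier.
\<close>

definition indep_set ::
  "'a topology \<Rightarrow> ('a \<Rightarrow> 'a) \<Rightarrow> nat \<Rightarrow> (nat \<Rightarrow> 'a set) \<Rightarrow> nat set \<Rightarrow> bool" where
  "indep_set X T k A F \<longleftrightarrow>
     (\<forall>J s. J \<noteq> {} \<and> finite J \<and> J \<subseteq> F \<and> s \<in> J \<rightarrow> {1..k} \<longrightarrow>
        (\<Inter>j\<in>J. {x \<in> topspace X. (T ^^ j) x \<in> A (s j)}) \<noteq> {})"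

definition Ind :: "'a topology \<Rightarrow> ('a \<Rightarrow> 'a) \<Rightarrow> nat \<Rightarrow> (nat \<Rightarrow> 'a set) \<Rightarrow> nat set set" where
  "Ind X T k A = {F. indep_set X T k A F}"

definition family_independent ::
  "'a topology \<Rightarrow> ('a \<Rightarrow> 'a) \<Rightarrow> nat set set \<Rightarrow> nat \<Rightarrow> bool" where
  "family_independent X T \<F> k \<longleftrightarrow>
     (\<forall>U. (\<forall>i\<in>{1..k}. openin X (U i) \<and> U i \<noteq> {}) \<longrightarrow> Ind X T k U \<inter> \<F> \<noteq> {})"

text \<open>
  \<^term>\<open>enumerate S\<close> lists an infinite \<open>S\<close> in strictly increasing order, so the subtraction of
  natural numbers below does not truncate.
\<close>

definition syndetic :: "nat set \<Rightarrow> bool" where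
  "syndetic S \<longleftrightarrow>
     infinite S \<and> bdd_above (range (\<lambda>n. enumerate S (Suc n) - enumerate S n))"

definition syndetic_sets :: "nat set set" where
  "syndetic_sets = {S. syndetic S}"

end

theory Submission
  imports Defs
begin

text \<open>
  In a minimal system every nonempty open set \<open>W\<close> is visited by every orbit, and by compactness
  within a bounded time. A syndetic independence set \<open>F\<close> makes it possible to prescribe an orbit
  along \<open>F\<close> so that it misses some \<open>W\<close> for as long as desired, which is a contradiction.

  In detail, choose nonempty open sets \<open>U\<^sub>1\<close>, \<open>U\<^sub>2\<close> and an open cover \<open>G\<^sub>1\<close>, \<open>G\<^sub>2\<close> of the space
  such that \<open>U\<^sub>b\<close> and \<open>G\<^sub>b\<close> are disjoint (lemma \<open>regular_space_separating_cover\<close>). A point \<open>z\<close> has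
  an itinerary \<open>a\<close> with respect to this cover, and the points that share its first \<open>M\<close> entries form
  an open set \<open>W\<close>. If the orbit of \<open>x\<close> follows the symbols \<open>s\<close> along \<open>F\<close>, in the sense that
  \<open>T\<^sup>j x \<in> U\<^bsub>s(j)\<^esub>\<close> for \<open>j \<in> F\<close>, then a single \<open>j \<in> F\<close> with \<open>n \<le> j < n + M\<close> and
  \<open>s(j) = a(j - n)\<close> already prevents \<open>T\<^sup>n x \<in> W\<close>. Hence it suffices to find one \<open>s\<close> that has such
  a \<open>j\<close> for every \<open>n\<close>.

  This is a counting argument (lemma \<open>sequence_meeting_word_at_every_shift\<close>). A block of length \<open>C\<close>
  contains a number of elements of \<open>F\<close> that is proportional to \<open>C\<close>, so the number of choices of \<open>s\<close>
  there is exponential in \<open>C\<close>. The \<open>C\<close> shifts \<open>n\<close> from the preceding block forbid only one choice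
  each. So for large \<open>C\<close> some choice serves all of them, and since distinct blocks of shifts
  use disjoint parts of \<open>F\<close>, the choices can be made independently.
\<close>

section \<open>Sequences along a syndetic set that avoid a word\<close>

lemma syndetic_meets_intervals:
  assumes "syndetic F"
  obtains L where "\<And>t. F \<inter> {t..<t + L} \<noteq> {}"
proof -
  let ?e = "enumerate F"
  from assms have inf: "infinite F"
    and bdd: "bdd_above (range (\<lambda>n. ?e (Suc n) - ?e n))"
    by (auto simp: syndetic_def)
  from bdd obtain g where "\<And>n. ?e (Suc n) - ?e n \<le> g"
    by (auto simp: bdd_above_def)
  then have gap: "?e (Suc n) \<le> ?e n + g" for n
    by (metis le_diff_conv add.commute)
  \<comment> \<open>The first element of the set bounds the initial gap, which the differences do not see.\<close>
  have "F \<inter> {t..<t + Suc (?e 0 + g)} \<noteq> {}" for t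
  proof -
    define k where "k = (LEAST k. t \<le> ?e k)"
    have k: "t \<le> ?e k"
      unfolding k_def using le_enumerate[OF inf] by (rule LeastI)
    have "?e k < t + Suc (?e 0 + g)"
    proof (cases k)
      case 0
      then show ?thesis by simp
    next
      case (Suc i)
      then have "?e i < t"
        using not_less_Least[of i "\<lambda>k. t \<le> ?e k"] unfolding k_def by simp
      with gap[of i] Suc show ?thesis by simp
    qed
    with k enumerate_in_set[OF inf, of k] show ?thesis by auto
  qed
  with that show thesis by blast
qed

lemma card_Int_interval_ge:
  fixes F :: "nat set"
  assumes "\<And>t. F \<inter> {t..<t + L} \<noteq> {}"
  shows "m \<le> card (F \<inter> {q..<q + m * L})"
proof (induction m)
  case (Suc m)
  let ?A = "F \<inter> {q..<q + m * L}" and ?B = "F \<inter> {q + m * L..<(q + m * L) + L}"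
  have "card ?B \<ge> 1"
    using assms[of "q + m * L"] by (simp add: Suc_le_eq card_gt_0_iff)
  moreover have "card (?A \<union> ?B) = card ?A + card ?B"
    by (rule card_Un_disjoint) auto
  moreover have "F \<inter> {q..<q + Suc m * L} = ?A \<union> ?B"
  proof -
    have "{q..<q + Suc m * L} = {q..<q + m * L} \<union> {q + m * L..<(q + m * L) + L}"
      using ivl_disj_un_two(3)[of q "q + m * L" "(q + m * L) + L"] by (simp add: ac_simps)
    then show ?thesis by (simp add: Int_Un_distrib)
  qed
  ultimately show ?case using Suc by simp
qed simp

text \<open>
  Each \<open>n \<in> I\<close> excludes exactly one subset \<open>P\<close> of \<open>S\<close>, namely the one that disagrees with the
  shifted word at every place; there are \<open>2\<^bsup>card S\<^esup>\<close> subsets to choose from.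
\<close>

lemma pattern_meeting_word_at_shifts:
  fixes a :: "nat \<Rightarrow> bool"
  assumes "finite S" "finite I" "card I < 2 ^ card S"
  shows "\<exists>P. \<forall>n\<in>I. \<exists>j\<in>S. (j \<in> P) = a (j - n)"
proof -
  let ?bad = "\<lambda>n. {j\<in>S. \<not> a (j - n)}"
  have "card (?bad ` I) < card (Pow S)"
    using card_image_le[OF \<open>finite I\<close>, of ?bad] assms by (simp add: card_Pow)
  then have "\<not> Pow S \<subseteq> ?bad ` I"
    using card_mono[of "?bad ` I" "Pow S"] \<open>finite I\<close> by auto
  then obtain P where "P \<subseteq> S" "P \<notin> ?bad ` I"
    by (auto simp only: subset_iff Pow_iff)
  have "\<exists>j\<in>S. (j \<in> P) = a (j - n)" if "n \<in> I" for n
  proof (rule ccontr)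
    assume "\<not> ?thesis"
    with \<open>P \<subseteq> S\<close> have "P = ?bad n" by auto
    with \<open>P \<notin> ?bad ` I\<close> \<open>n \<in> I\<close> show False by blast
  qed
  then show ?thesis by blast
qed

text \<open>
  The bound \<open>M\<close> on the length of the word depends only on \<open>F\<close>, which allows the word to be read off
  from an orbit after \<open>F\<close> is known.
\<close>

lemma sequence_meeting_word_at_every_shift:
  assumes "syndetic F"
  obtains M where
    "\<And>a :: nat \<Rightarrow> bool. \<exists>s. \<forall>n. \<exists>j\<in>F. n \<le> j \<and> j < n + M \<and> s j = a (j - n)"
proof -
  obtain L where L: "\<And>t. F \<inter> {t..<t + L} \<noteq> {}"
    using syndetic_meets_intervals[OF assms] by metis
  \<comment> \<open>With \<open>m = 2L\<close> the block length \<open>m L\<close> is below \<open>2\<^sup>m\<close>, because \<open>2 L \<le> 2\<^sup>L\<close> and \<open>L < 2\<^sup>L\<close>.\<close>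
  define m where "m = 2 * L"
  define C where "C = m * L"
  have "L > 0" using L[of 0] by (cases L) auto
  then have "C > 0" by (simp add: C_def m_def)
  have C_less: "C < 2 ^ m"
  proof -
    have "2 * L \<le> 2 ^ L"
    proof (cases L)
      case (Suc k)
      have "Suc k \<le> 2 ^ k" using less_exp[of k] by (rule Suc_leI)
      then show ?thesis unfolding Suc power_Suc by (rule mult_le_mono2)
    qed simp
    then have "(2 * L) * L < 2 ^ L * 2 ^ L"
      using less_exp[of L] by (intro mult_le_less_imp_less) (use \<open>L > 0\<close> in auto)
    then show ?thesis by (simp add: C_def m_def mult_2 power_add)
  qed
  have "\<exists>s. \<forall>n. \<exists>j\<in>F. n \<le> j \<and> j < n + 2 * C \<and> s j = a (j - n)" for a :: "nat \<Rightarrow> bool"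
  proof -
    define S where "S k = F \<inter> {Suc k * C..<Suc k * C + C}" for k
    have "\<exists>P. \<forall>n\<in>{k * C..<k * C + C}. \<exists>j\<in>S k. (j \<in> P) = a (j - n)" for k
    proof (rule pattern_meeting_word_at_shifts)
      have "(2::nat) ^ m \<le> 2 ^ card (S k)"
        using card_Int_interval_ge[OF L, of m "Suc k * C"] by (simp add: S_def C_def)
      then show "card {k * C..<k * C + C} < 2 ^ card (S k)"
        using C_less by (simp del: power_increasing_iff)
    qed (auto simp: S_def)
    then obtain P where
      P: "\<And>k n. n \<in> {k * C..<k * C + C} \<Longrightarrow> \<exists>j\<in>S k. (j \<in> P k) = a (j - n)"
      by metis
    \<comment> \<open>Shifts in block \<open>k\<close> are served by block \<open>k + 1\<close>, so a place looks up the preceding block.\<close>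
    define s where "s j \<longleftrightarrow> j \<in> P (j div C - 1)" for j
    have "\<exists>j\<in>F. n \<le> j \<and> j < n + 2 * C \<and> s j = a (j - n)" for n
    proof -
      define k where "k = n div C"
      have n: "k * C \<le> n" "n < k * C + C"
        using \<open>C > 0\<close> unfolding k_def
        using dividend_less_div_times[of C n] by (simp_all add: add.commute)
      then obtain j where j: "j \<in> S k" "(j \<in> P k) = a (j - n)"
        using P[of n k] by auto
      from j(1) have "Suc k * C \<le> j" "j < Suc (Suc k) * C"
        by (auto simp: S_def)
      then have "j div C = Suc k"
        by (intro div_nat_eqI) (auto simp: mult.commute)
      with j n show ?thesis
        by (intro bexI[of _ j]) (auto simp: S_def s_def)
    qed
    then show ?thesis by blast
  qed
  with that show thesis by blast
qed

section \<open>Hitting times in minimal systems\<close>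

lemma continuous_map_funpow:
  assumes "continuous_map X X T"
  shows "continuous_map X X (T ^^ n)"
proof (induction n)
  case (Suc n)
  then show ?case using continuous_map_compose[OF Suc assms] by (simp only: funpow.simps)
qed simp

lemma minimal_orbit_meets_open:
  assumes "minimal_tds X T" "openin X W" "W \<noteq> {}" "x \<in> topspace X"
  shows "\<exists>n. (T ^^ n) x \<in> W"
proof -
  let ?O = "{(T ^^ n) x |n. True}"
  have "X closure_of ?O = topspace X"
    using assms(1,4) unfolding minimal_tds_def by blast
  then have "W \<inter> X closure_of ?O \<noteq> {}"
    using openin_subset[OF \<open>openin X W\<close>] \<open>W \<noteq> {}\<close> by (simp only: Int_absorb2) simp
  then have "W \<inter> ?O \<noteq> {}"
    using openin_Int_closure_of_eq_empty[OF \<open>openin X W\<close>, of ?O] by simp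
  then show ?thesis by blast
qed

lemma minimal_bounded_hitting_time:
  assumes min: "minimal_tds X T" and W: "openin X W" "W \<noteq> {}"
  obtains N where "\<And>x. x \<in> topspace X \<Longrightarrow> \<exists>n\<le>N. (T ^^ n) x \<in> W"
proof -
  from min have cmp: "compact_space X" and T: "continuous_map X X T"
    by (auto simp: minimal_tds_def tds_def)
  let ?V = "\<lambda>n. {x \<in> topspace X. (T ^^ n) x \<in> W}"
  have "openin X (?V n)" for n
    by (rule openin_continuous_map_preimage[OF continuous_map_funpow[OF T] W(1)])
  then have "\<forall>U\<in>range ?V. openin X U"
    by (simp only: ball_simps) simp
  moreover have "topspace X \<subseteq> \<Union>(range ?V)"
  proof
    fix x assume "x \<in> topspace X"
    moreover from minimal_orbit_meets_open[OF min W this] obtain n where "(T ^^ n) x \<in> W" ..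
    ultimately show "x \<in> \<Union>(range ?V)" by (intro UN_I[of n]) simp_all
  qed
  ultimately obtain \<F> where \<F>: "finite \<F>" "\<F> \<subseteq> range ?V" "topspace X \<subseteq> \<Union>\<F>"
    using cmp[unfolded compact_space_alt, rule_format, of "range ?V"] by fast
  then obtain K where K: "finite K" "\<F> = ?V ` K"
    using finite_subset_image[OF \<F>(1,2)] by auto
  have "\<exists>n\<le>Max K. (T ^^ n) x \<in> W" if x: "x \<in> topspace X" for x
  proof -
    obtain n where "n \<in> K" "(T ^^ n) x \<in> W"
      using x \<F>(3) unfolding K(2) by auto
    with Max_ge[OF K(1)] show ?thesis by auto
  qed
  with that show thesis by metis
qed

section \<open>Minimality against syndetic independence\<close>

text \<open>
  Disjoint \<open>U\<close> and \<open>V\<close> alone would not do: the set of points with a given itinerary has to be open,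
  so itineraries are taken with respect to an open cover, and its members are allowed to overlap.
\<close>

lemma regular_space_separating_cover:
  assumes "regular_space X" "Hausdorff_space X" "p \<in> topspace X" "q \<in> topspace X" "p \<noteq> q"
  obtains U V G H where
    "openin X U" "openin X V" "openin X G" "openin X H" "U \<noteq> {}" "V \<noteq> {}"
    "disjnt U G" "disjnt V H" "topspace X \<subseteq> G \<union> H"
proof -
  obtain H V where HV: "openin X H" "openin X V" "p \<in> H" "q \<in> V" "disjnt H V"
    using assms unfolding Hausdorff_space_def by blast
  then have "closedin X (topspace X - H)" "p \<in> topspace X - (topspace X - H)"
    using assms by auto
  then obtain U G where "openin X U" "openin X G" "p \<in> U" "topspace X - H \<subseteq> G" "disjnt U G"
    using assms(1) unfolding regular_space_def by metis
  with HV show thesis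
    using that[of U V G H] by (auto simp: disjnt_sym)
qed

theorem theorem5p11:
  "\<not> (\<exists>(X :: 'a topology) (T :: 'a \<Rightarrow> 'a).
        nontrivial_tds X T \<and> minimal_tds X T \<and> family_independent X T syndetic_sets 2)"
proof
  assume "\<exists>(X :: 'a topology) (T :: 'a \<Rightarrow> 'a).
    nontrivial_tds X T \<and> minimal_tds X T \<and> family_independent X T syndetic_sets 2"
  then obtain X :: "'a topology" and T :: "'a \<Rightarrow> 'a" where
    nontriv: "nontrivial_tds X T" and min: "minimal_tds X T"
    and indep: "family_independent X T syndetic_sets 2"
    by blast
  from nontriv obtain z q where z: "z \<in> topspace X" and q: "q \<in> topspace X" "z \<noteq> q"
    and metr: "metrizable_space X" and T: "continuous_map X X T"
    unfolding nontrivial_tds_def tds_def by blast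
  have pow_in: "(T ^^ i) x \<in> topspace X" if "x \<in> topspace X" for i x
    using continuous_map_funpow[OF T, of i] that by (auto simp: continuous_map_def)
  obtain U V G H where
    op: "openin X U" "openin X V" "openin X G" "openin X H" and ne: "U \<noteq> {}" "V \<noteq> {}"
    and disj: "disjnt U G" "disjnt V H" and cover: "topspace X \<subseteq> G \<union> H"
    using regular_space_separating_cover[OF metrizable_imp_regular_space[OF metr]
        metrizable_imp_Hausdorff_space[OF metr] z q] .
  define A where "A i = (if i = 1 then U else V)" for i :: nat
  have "\<forall>i\<in>{1..2}. openin X (A i) \<and> A i \<noteq> {}"
    using op ne by (simp add: A_def)
  then obtain F where "syndetic F" and F: "indep_set X T 2 A F"
    using indep unfolding family_independent_def Ind_def syndetic_sets_def by blast
  obtain M where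
    M: "\<And>a :: nat \<Rightarrow> bool. \<exists>s. \<forall>n. \<exists>j\<in>F. n \<le> j \<and> j < n + M \<and> s j = a (j - n)"
    using sequence_meeting_word_at_every_shift[OF \<open>syndetic F\<close>] by blast

  define a where "a i \<longleftrightarrow> (T ^^ i) z \<in> G" for i
  define B where "B b = (if b then G else H)" for b
  define W where "W = (\<Inter>i<M. {x \<in> topspace X. (T ^^ i) x \<in> B (a i)}) \<inter> topspace X"
  have "z \<in> W"
    using z pow_in[OF z] cover by (auto simp: W_def a_def B_def)
  moreover have "openin X W"
  proof -
    have "openin X (B (a i))" for i
      using op by (simp add: B_def)
    then have "openin X {x \<in> topspace X. (T ^^ i) x \<in> B (a i)}" for i
      by (rule openin_continuous_map_preimage[OF continuous_map_funpow[OF T]])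
    then show ?thesis unfolding W_def
      by (intro openin_INT) simp
  qed
  ultimately obtain N where N: "\<And>x. x \<in> topspace X \<Longrightarrow> \<exists>n\<le>N. (T ^^ n) x \<in> W"
    using minimal_bounded_hitting_time[OF min] by blast

  obtain s where s: "\<And>n. \<exists>j\<in>F. n \<le> j \<and> j < n + M \<and> s j = a (j - n)"
    using M[of a] by blast
  define \<sigma> :: "nat \<Rightarrow> nat" where "\<sigma> j = (if s j then 1 else 2)" for j
  \<comment> \<open>Only times \<open>n \<le> N\<close> have to be blocked, so a finite part of \<open>F\<close> is enough.\<close>
  define J where "J = F \<inter> {..<N + M}"
  have "J \<noteq> {}" using s[of N] by (auto simp: J_def)
  moreover have "finite J" "J \<subseteq> F" "\<sigma> \<in> J \<rightarrow> {1..2}"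
    by (auto simp: J_def \<sigma>_def)
  ultimately have "(\<Inter>j\<in>J. {x \<in> topspace X. (T ^^ j) x \<in> A (\<sigma> j)}) \<noteq> {}"
    using F unfolding indep_set_def by blast
  then obtain x where "x \<in> topspace X" and x: "\<And>j. j \<in> J \<Longrightarrow> (T ^^ j) x \<in> A (\<sigma> j)"
    using \<open>J \<noteq> {}\<close> by blast
  obtain n where "n \<le> N" and n: "(T ^^ n) x \<in> W"
    using N[OF \<open>x \<in> topspace X\<close>] by blast
  obtain j where j: "j \<in> F" "n \<le> j" "j < n + M" "s j = a (j - n)"
    using s by blast
  have "(T ^^ (j - n)) ((T ^^ n) x) \<in> B (a (j - n))"
    using n j by (auto simp: W_def)
  moreover have "(T ^^ (j - n)) ((T ^^ n) x) = (T ^^ j) x"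
    using \<open>n \<le> j\<close> by (metis comp_apply funpow_add le_add_diff_inverse2)
  ultimately have "(T ^^ j) x \<in> B (s j)"
    using j by simp
  moreover have "(T ^^ j) x \<in> A (\<sigma> j)"
    using x j \<open>n \<le> N\<close> by (simp add: J_def)
  ultimately show False
    using disj by (auto simp: A_def B_def \<sigma>_def disjnt_iff split: if_splits)
qed

end
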